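(* Let $\mu$, $m$, $G_{2m}$, $\nu$, $z_1,\dots,z_{2m}$ be as in the context, and assume all zeros of $G_{2m}$ are simple. Let $\mathcal P=\{p_0,\dots,p_{2m}\}$ with $p_j(z)=z^{\lfloor j/2\rfloor}$, and $\widehat{\mathcal P}=\{\widehat p_0,\dots,\widehat p_{2m}\}$ with $\widehat p_j(z)=z^{\lfloor (j+1)/2\rfloor}$, $j=0,1,\dots,2m$. Then for every $n\ge0$ and every $w$ with $|w|=1$, both $C_n^{(\mathcal P)}(w)\ne0$ and $C_n^{(\widehat{\mathcal P})}(w)\neq0$.
   Context: $\mathbb T=\{\zeta\in\mathbb C:|\zeta|=1\}$. $\mu$ is a nontrivial (i.e. with infinite support) positive finite Borel measure on $\mathbb T$. For such a measure, $\varphi_k(z;\mu)$, $k\ge0$, are the orthonormal polynomials ($\deg\varphi_k=k$, positive leading coefficient), and the Christoffel-Darboux (CD) kernel is $K_n(z,w;\mu)=\sum_{k=0}^n\overline{\varphi_k(w;\mu)}\,\varphi_k(z;\mu)$, $n\ge0$. $m\ge1$ is an integer and $G_{2m}$ is a polynomial of exact degree $2m$ that is self-reciprocal, i.e. $z^{2m}\overline{G_{2m}(1/\overline z)}=G_{2m}(z)$, and such that $G_{2m}(\zeta)/\zeta^m\ge0$ on $\operatorname{supp}(\mu)$. The positive measure $\nu$ is $d\nu(\zeta)=\frac{G_{2m}(\zeta)}{\zeta^m}\,d\mu(\zeta)=|G_{2m}(\zeta)|\,d\mu(\zeta)$, with CD kernels $K_n(z,w;\nu)$. The zeros of $G_{2m}$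 are $z_1,\dots,z_{2m}$. For a set $\mathcal R=\{r_0,\dots,r_{2m}\}$ equal to $\mathcal P$ or $\widehat{\mathcal P}$ and fixed $n$, put $Q_j^{(\mathcal R)}(z,w):=r_j(z)\,K_{n+2m-j}(z,w;\mu)$; with $z_0:=z$, $\boldsymbol Q^{(\mathcal R)}(z,w)$ is the $(2m+1)\times(2m+1)$ matrix with entries $Q_j^{(\mathcal R)}(z_i,w)$, $i,j=0,\dots,2m$. $C_n^{(\mathcal R)}$ denotes the polynomial such that $\det\boldsymbol Q^{(\mathcal R)}(z,w)=C_n^{(\mathcal R)}(\overline w)\,G_{2m}(z)\,K_n(z,w;\nu)$ for all $z,w\in\mathbb C$. *)

theory Defs
  imports
    "HOL-Analysis.Analysis"
    "HOL-Library.Nonpos_Ints"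
    "HOL-Computational_Algebra.Polynomial"
    "Jordan_Normal_Form.Determinant"
begin

definition measure_on_circle :: "complex measure \<Rightarrow> bool" where
  "measure_on_circle \<mu> \<longleftrightarrow>
     sets \<mu> = sets (restrict_space borel (sphere 0 1)) \<and> finite_measure \<mu>"

definition supp_measure :: "'a::topological_space measure \<Rightarrow> 'a set" where
  "supp_measure \<mu> =
     {x \<in> space \<mu>. \<forall>U. open U \<and> x \<in> U \<longrightarrow> emeasure \<mu> (U \<inter> space \<mu>) > 0}"

definition nontrivial_measure_on_circle :: "complex measure \<Rightarrow> bool" where
  "nontrivial_measure_on_circle \<mu> \<longleftrightarrow> measure_on_circle \<mu> \<and> infinite (supp_measure \<mu>)"

definition is_orthonormal_polys :: "complex measure \<Rightarrow> (nat \<Rightarrow> complex poly) \<Rightarrow> bool" where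
  "is_orthonormal_polys \<mu> \<phi> \<longleftrightarrow>
     (\<forall>k. degree (\<phi> k) = k \<and> lead_coeff (\<phi> k) \<in> \<real> \<and> Re (lead_coeff (\<phi> k)) > 0) \<and>
     (\<forall>j k. (LINT \<zeta>|\<mu>. poly (\<phi> j) \<zeta> * cnj (poly (\<phi> k) \<zeta>)) = (if j = k then 1 else 0))"

text \<open>For a nontrivial measure on the circle the orthonormal system exists (Gram-Schmidt applied
  to the monomials) and is unique, so the description below is proper.\<close>

definition orthonormal_poly :: "complex measure \<Rightarrow> nat \<Rightarrow> complex poly" where
  "orthonormal_poly \<mu> = (THE \<phi>. is_orthonormal_polys \<mu> \<phi>)"

definition CD_kernel :: "nat \<Rightarrow> complex \<Rightarrow> complex \<Rightarrow> complex measure \<Rightarrow> complex" where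
  "CD_kernel n z w \<mu> =
     (\<Sum>k\<le>n. cnj (poly (orthonormal_poly \<mu> k) w) * poly (orthonormal_poly \<mu> k) z)"

text \<open>The point 0 is excluded because \<open>1 / 0 = 0\<close>; the identity off 0 already
  determines the polynomial.\<close>

definition self_reciprocal :: "nat \<Rightarrow> complex poly \<Rightarrow> bool" where
  "self_reciprocal N G \<longleftrightarrow> (\<forall>z. z \<noteq> 0 \<longrightarrow> z ^ N * cnj (poly G (1 / cnj z)) = poly G z)"

text \<open>The measure with density \<open>|G|\<close>; it is \<open>G(\<zeta>)/\<zeta>^m d\<mu>\<close> whenever
  \<open>G(\<zeta>)/\<zeta>^m\<close> is nonnegative on the support of \<open>\<mu>\<close>, whose complement is a null set.\<close>

definition modified_measure :: "complex poly \<Rightarrow> complex measure \<Rightarrow> complex measure" where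
  "modified_measure G \<mu> = density \<mu> (\<lambda>\<zeta>. ennreal (norm (poly G \<zeta>)))"

definition Q_fun ::
  "complex measure \<Rightarrow> nat \<Rightarrow> (nat \<Rightarrow> complex poly) \<Rightarrow> nat \<Rightarrow> nat \<Rightarrow> complex \<Rightarrow> complex \<Rightarrow> complex"
where
  "Q_fun \<mu> m r n j z w = poly (r j) z * CD_kernel (n + 2 * m - j) z w \<mu>"

text \<open>The zeros of \<open>G\<close> are \<open>zs 1, \<dots>, zs (2 * m)\<close>; slot 0 is overwritten by the variable
  \<open>z\<close>.\<close>

definition Q_mat ::
  "complex measure \<Rightarrow> nat \<Rightarrow> (nat \<Rightarrow> complex) \<Rightarrow> (nat \<Rightarrow> complex poly) \<Rightarrow> nat \<Rightarrow>
   complex \<Rightarrow> complex \<Rightarrow> complex Matrix.mat"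
where
  "Q_mat \<mu> m zs r n z w =
     Matrix.mat (2 * m + 1) (2 * m + 1) (\<lambda>(i, j). Q_fun \<mu> m r n j ((zs(0 := z)) i) w)"

text \<open>If \<open>zs 1, \<dots>, zs (2 * m)\<close> are the zeros of \<open>G\<close>, all of them simple, and \<open>r\<close> is one of the
  two families below, there is exactly one such polynomial.\<close>

definition C_poly ::
  "complex measure \<Rightarrow> nat \<Rightarrow> complex poly \<Rightarrow> (nat \<Rightarrow> complex) \<Rightarrow> (nat \<Rightarrow> complex poly) \<Rightarrow> nat \<Rightarrow>
   complex poly"
where
  "C_poly \<mu> m G zs r n =
     (THE C. \<forall>z w. Determinant.det (Q_mat \<mu> m zs r n z w) =
        poly C (cnj w) * poly G z * CD_kernel n z w (modified_measure G \<mu>))"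

definition p_fam :: "nat \<Rightarrow> complex poly" where
  "p_fam j = Polynomial.monom 1 (j div 2)"

definition p_hat_fam :: "nat \<Rightarrow> complex poly" where
  "p_hat_fam j = Polynomial.monom 1 ((j + 1) div 2)"

end

(* Put Q_j = z^e_j K_(n+2m-j)(., w; mu), the entries of the first row. Suppose a combination f of the
   Q_j vanishes at all zeros of G, so f = G h. Testing h against polynomials of degree at most n in
   L^2(nu) and using the reproducing property for mu shows that h is a multiple of K_n(., w; nu), with
   a factor that is polynomial in the conjugate of w. Applied to the expansion of det Q along its
   first row, this yields C_n. On the circle K_N(., w; mu) has exact degree N and does not vanish at 0,
   so the Q_j are linearly independent. If C_n vanished there, det Q(z, w) would be 0 at a point z
   with G(z) K_n(z, w; nu) nonzero, and a kernel vector of Q(z, w) would give a combination f of the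
   Q_j vanishing at z and at all zeros of G, hence f = 0, a contradiction. *)

theory Submission
  imports Defs
begin

hide_const (open) Module.module.smult

section \<open>Polynomials in L^2 of a measure on the circle\<close>

definition ip :: "complex measure \<Rightarrow> complex poly \<Rightarrow> complex poly \<Rightarrow> complex" where
  "ip M p q = (LINT \<zeta>|M. poly p \<zeta> * cnj (poly q \<zeta>))"

text \<open>\<open>CD_kernel\<close> is only a function of its arguments. For fixed
  \<open>w\<close>, this is the polynomial in z behind it, so that degrees, coefficients and inner
  products can be used.\<close>

definition CD_poly :: "complex measure \<Rightarrow> nat \<Rightarrow> complex \<Rightarrow> complex poly" where
  "CD_poly M N w = (\<Sum>k\<le>N. smult (cnj (poly (orthonormal_poly M k) w)) (orthonormal_poly M k))"

lemma is_orthonormal_polysD: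
  assumes "is_orthonormal_polys M \<phi>"
  shows "degree (\<phi> k) = k" "lead_coeff (\<phi> k) \<in> \<real>" "Re (lead_coeff (\<phi> k)) > 0" "\<phi> k \<noteq> 0"
    "ip M (\<phi> j) (\<phi> k) = (if j = k then 1 else 0)"
proof -
  note * = assms[unfolded is_orthonormal_polys_def, folded ip_def]
  show "degree (\<phi> k) = k" "lead_coeff (\<phi> k) \<in> \<real>" "Re (lead_coeff (\<phi> k)) > 0"
    using *[THEN conjunct1, THEN spec, of k] by blast+
  then show "\<phi> k \<noteq> 0" by auto
  show "ip M (\<phi> j) (\<phi> k) = (if j = k then 1 else 0)"
    using * by simp
qed

locale circle_measure =
  fixes M :: "complex measure"
  assumes circle: "measure_on_circle M"
begin

lemma sets_M: "sets M = sets (restrict_space borel (sphere 0 1))"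
  using circle by (simp add: measure_on_circle_def)

lemma space_M: "space M = sphere 0 1"
  using sets_eq_imp_space_eq[OF sets_M] by (simp add: space_restrict_space)

sublocale finite_measure M
  using circle by (simp add: measure_on_circle_def)

lemma norm_space: "x \<in> space M \<Longrightarrow> norm x = 1"
  by (simp add: space_M)

lemma measurable_continuous:
  fixes f :: "complex \<Rightarrow> 'b::topological_space"
  assumes "continuous_on UNIV f"
  shows "f \<in> borel_measurable M"
proof -
  have "f \<in> borel_measurable borel"
    by (rule borel_measurable_continuous_onI[OF assms])
  then have "f \<in> borel_measurable (restrict_space borel (sphere 0 1))"
    by (rule measurable_restrict_space1)
  then show ?thesis
    using measurable_cong_sets[OF sets_M refl] by blast
qed

lemma integrable_continuous:
  fixes f :: "complex \<Rightarrow> 'b::{banach, second_countable_topology}"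
  assumes "continuous_on UNIV f"
  shows "integrable M f"
proof -
  have "compact (f ` sphere 0 1)"
    by (intro compact_continuous_image continuous_on_subset[OF assms]) auto
  then obtain B where B: "\<And>x. x \<in> sphere 0 1 \<Longrightarrow> norm (f x) \<le> B"
    using compact_imp_bounded bounded_iff by (metis imageI)
  show ?thesis
    by (rule integrable_const_bound[where B = B])
       (use B measurable_continuous[OF assms] in \<open>auto simp: space_M\<close>)
qed

lemma integrable_ip [simp]: "integrable M (\<lambda>\<zeta>. poly p \<zeta> * cnj (poly q \<zeta>))"
  by (intro integrable_continuous continuous_intros)

lemma ip_add_left: "ip M (p + p') q = ip M p q + ip M p' q"
  unfolding ip_def by (simp add: distrib_right)

lemma ip_diff_left: "ip M (p - p') q = ip M p q - ip M p' q"
  unfolding ip_def by (simp add: left_diff_distrib)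

lemma ip_smult_left: "ip M (smult a p) q = a * ip M p q"
  unfolding ip_def by (simp add: mult.assoc)

lemma ip_zero_left [simp]: "ip M 0 q = 0"
  unfolding ip_def by simp

lemma ip_sum_left: "ip M (sum f A) q = (\<Sum>i\<in>A. ip M (f i) q)"
  by (induction A rule: infinite_finite_induct) (simp_all add: ip_add_left)

lemma ip_cnj: "cnj (ip M p q) = ip M q p"
  unfolding ip_def by (subst Bochner_Integration.integral_cnj[symmetric]) (simp add: mult.commute)

lemma ip_add_right: "ip M q (p + p') = ip M q p + ip M q p'"
  by (metis ip_cnj ip_add_left complex_cnj_add)

lemma ip_diff_right: "ip M q (p - p') = ip M q p - ip M q p'"
  by (metis ip_cnj ip_diff_left complex_cnj_diff)

lemma ip_smult_right: "ip M q (smult a p) = cnj a * ip M q p"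
  by (metis ip_cnj ip_smult_left complex_cnj_mult)

lemma ip_sum_right: "ip M q (sum f A) = (\<Sum>i\<in>A. ip M q (f i))"
  by (induction A rule: infinite_finite_induct) (simp_all add: ip_add_right flip: ip_cnj[of 0])

text \<open>Powers of z have modulus 1 on the circle, so multiplying by them is an isometry.\<close>

lemma ip_monom_mult: "ip M (monom 1 k * p) (monom 1 k * q) = ip M p q"
  unfolding ip_def
proof (rule Bochner_Integration.integral_cong[OF refl])
  fix \<zeta> assume "\<zeta> \<in> space M"
  then have "\<zeta> ^ k * cnj (\<zeta> ^ k) = 1"
    using complex_norm_square[of "\<zeta> ^ k"] by (simp add: norm_space norm_power)
  then show "poly (monom 1 k * p) \<zeta> * cnj (poly (monom 1 k * q) \<zeta>) = poly p \<zeta> * cnj (poly q \<zeta>)"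
    by (simp add: poly_monom)
qed

lemma ip_self: "ip M p p = of_real (LINT \<zeta>|M. (norm (poly p \<zeta>))\<^sup>2)"
  unfolding ip_def by (simp flip: complex_norm_square integral_complex_of_real)

text \<open>The complement of the support is covered by the open null sets, and by Lindelof
  countably many of them suffice.\<close>

lemma AE_supp: "AE x in M. x \<in> supp_measure M"
proof -
  define F where "F = {U. open U \<and> emeasure M (U \<inter> space M) = 0}"
  obtain F' where F': "F' \<subseteq> F" "countable F'" "\<Union>F' = \<Union>F"
    using Lindelof[of F] by (auto simp: F_def)
  have sets: "U \<inter> space M \<in> sets M" if "open U" for U
    using that by (auto simp: sets_M space_M sets_restrict_space)
  have "(\<Union>U\<in>F'. U \<inter> space M) \<in> null_sets M"
    using F' sets by (intro null_sets_UN') (auto simp: F_def null_sets_def)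
  moreover have "{x \<in> space M. \<not> x \<in> supp_measure M} \<subseteq> (\<Union>U\<in>F'. U \<inter> space M)"
  proof -
    have "{x \<in> space M. \<not> x \<in> supp_measure M} \<subseteq> \<Union>F \<inter> space M"
      by (auto simp: supp_measure_def F_def)
    then show ?thesis using F'(3) by auto
  qed
  ultimately show ?thesis by (rule AE_I')
qed

text \<open>The set where \<open>p\<close> is nonzero is open and null, so it misses the support. An
  infinite support would then lie among the finitely many roots of a nonzero
  \<open>p\<close>.\<close>

lemma AE_poly_eq_0:
  assumes "infinite (supp_measure M)" and "AE x in M. poly p x = 0"
  shows "p = 0"
proof (rule ccontr)
  assume "p \<noteq> 0"
  then have "finite {x. poly p x = 0}" by (rule poly_roots_finite)
  moreover have "supp_measure M \<subseteq> {x. poly p x = 0}"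
  proof (intro subsetI CollectI, rule ccontr)
    fix x assume x: "x \<in> supp_measure M" and "poly p x \<noteq> 0"
    let ?U = "{y. poly p y \<noteq> 0}"
    have "open ?U" by (intro open_Collect_neq continuous_intros)
    then have "emeasure M (?U \<inter> space M) > 0"
      using x \<open>poly p x \<noteq> 0\<close> by (auto simp: supp_measure_def)
    moreover have "emeasure M (?U \<inter> space M) = 0"
    proof -
      have "?U \<inter> space M \<in> sets M"
        using \<open>open ?U\<close> by (auto simp: sets_M space_M sets_restrict_space)
      then have "?U \<inter> space M \<in> null_sets M"
        using assms(2) by (subst (asm) AE_iff_null) (auto simp: Int_def conj_commute)
      then show ?thesis by blast
    qed
    ultimately show False by simp
  qed
  ultimately show False using assms(1) finite_subset by blast
qed

end

section \<open>Orthonormal polynomials: uniqueness and existence\<close>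

text \<open>Cancels the coefficient at \<open>N\<close>. The zero polynomial is a separate case
  because its degree is 0, which is not below \<open>N\<close> when \<open>N = 0\<close>.\<close>

lemma poly_diff_lead_degree_less:
  fixes p q :: "'a::field poly"
  assumes "degree p \<le> N" "degree q = N" "q \<noteq> 0"
  shows "p - smult (coeff p N / lead_coeff q) q = 0 \<or>
         degree (p - smult (coeff p N / lead_coeff q) q) < N"
proof -
  let ?d = "p - smult (coeff p N / lead_coeff q) q"
  have "coeff ?d N = 0" using assms by auto
  moreover have "degree ?d \<le> N"
    using assms by (intro degree_diff_le) auto
  ultimately show ?thesis
    by (metis leading_coeff_0_iff nless_le)
qed

lemma poly_in_span:
  fixes \<phi> :: "nat \<Rightarrow> 'a::field poly"
  assumes deg: "\<And>k. degree (\<phi> k) = k" and nz: "\<And>k. \<phi> k \<noteq> 0" and "degree p \<le> N"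
  obtains a where "p = (\<Sum>k\<le>N. smult (a k) (\<phi> k))"
proof -
  have "\<exists>a. p = (\<Sum>k\<le>N. smult (a k) (\<phi> k))" using assms(3)
  proof (induction N arbitrary: p)
    case 0
    have "p - smult (coeff p 0 / lead_coeff (\<phi> 0)) (\<phi> 0) = 0"
      using poly_diff_lead_degree_less[of p 0 "\<phi> 0"] 0 deg nz by auto
    then show ?case
      by (intro exI[of _ "\<lambda>_. coeff p 0 / lead_coeff (\<phi> 0)"]) auto
  next
    case (Suc N)
    let ?b = "coeff p (Suc N) / lead_coeff (\<phi> (Suc N))"
    have "degree (p - smult ?b (\<phi> (Suc N))) \<le> N"
      using poly_diff_lead_degree_less[of p "Suc N" "\<phi> (Suc N)"] Suc.prems deg nz by auto
    then obtain a where a: "p - smult ?b (\<phi> (Suc N)) = (\<Sum>k\<le>N. smult (a k) (\<phi> k))"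
      using Suc.IH by blast
    have "p = (\<Sum>k\<le>Suc N. smult ((a(Suc N := ?b)) k) (\<phi> k))"
      using a by (simp add: algebra_simps)
    then show ?case by blast
  qed
  then show ?thesis using that by blast
qed

text \<open>Isolates the consequence of nontriviality on which the kernel theory rests, so that the
  theory applies to \<mu> and to \<nu> alike.\<close>

locale definite_circle_measure = circle_measure +
  assumes definite: "ip M p p = 0 \<Longrightarrow> p = 0"
begin

lemma ip_self_pos: "p \<noteq> 0 \<Longrightarrow> \<exists>r>0. ip M p p = of_real r"
proof -
  assume "p \<noteq> 0"
  let ?r = "LINT \<zeta>|M. (norm (poly p \<zeta>))\<^sup>2"
  have "?r \<noteq> 0" using definite[of p] ip_self[of p] \<open>p \<noteq> 0\<close> by auto
  moreover have "?r \<ge> 0" by simp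
  ultimately have "?r > 0" by linarith
  then show ?thesis using ip_self[of p] by blast
qed

lemma orthonormal_lower:
  assumes "is_orthonormal_polys M \<phi>" "p = 0 \<or> degree p < k"
  shows "ip M p (\<phi> k) = 0"
proof (cases "p = 0")
  case False
  with assms have "degree p \<le> k - 1" "k > 0" by auto
  have deg: "\<And>k. degree (\<phi> k) = k" "\<And>k. \<phi> k \<noteq> 0"
    by (rule is_orthonormal_polysD[OF assms(1)])+
  obtain a where a: "p = (\<Sum>j\<le>k-1. smult (a j) (\<phi> j))"
    by (rule poly_in_span[OF deg \<open>degree p \<le> k - 1\<close>])
  have "ip M (\<phi> j) (\<phi> k) = 0" if "j \<le> k - 1" for j
    using is_orthonormal_polysD(5)[OF assms(1)] that \<open>k > 0\<close> by auto
  then show ?thesis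
    by (subst a) (simp add: ip_sum_left ip_smult_left)
qed simp

text \<open>Subtracting a multiple of \<open>\<psi> k\<close> from \<open>\<phi> k\<close> to cancel
  the top coefficient leaves a polynomial orthogonal to both, hence to itself. The multiplier is
  positive by the sign convention and has modulus 1 by normalization.\<close>

lemma orthonormal_unique:
  assumes \<phi>: "is_orthonormal_polys M \<phi>" and \<psi>: "is_orthonormal_polys M \<psi>"
  shows "\<phi> = \<psi>"
proof
  fix k
  define a where "a = lead_coeff (\<phi> k) / lead_coeff (\<psi> k)"
  have facts: "degree (\<phi> k) = k" "degree (\<psi> k) = k" "\<psi> k \<noteq> 0"
    using is_orthonormal_polysD(1,4)[OF \<phi>] is_orthonormal_polysD(1,4)[OF \<psi>] by blast+
  define d where "d = \<phi> k - smult a (\<psi> k)"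
  have "d = 0 \<or> degree d < k"
    unfolding d_def a_def using poly_diff_lead_degree_less[of "\<phi> k" k "\<psi> k"] facts by simp
  then have "ip M d (\<phi> k) = 0" "ip M d (\<psi> k) = 0"
    using orthonormal_lower \<phi> \<psi> by auto
  then have "ip M d d = 0"
    by (subst (2) d_def) (simp add: ip_diff_right ip_smult_right)
  then have eq: "\<phi> k = smult a (\<psi> k)"
    using definite[of d] by (simp add: d_def)
  have "ip M (\<phi> k) (\<phi> k) = 1" "ip M (\<psi> k) (\<psi> k) = 1"
    using is_orthonormal_polysD(5)[OF \<phi>] is_orthonormal_polysD(5)[OF \<psi>] by simp_all
  then have "a * cnj a = 1"
    by (simp add: eq ip_smult_left ip_smult_right mult.commute)
  have pos_lead: "\<exists>x>0. lead_coeff (\<rho> k) = of_real x" if "is_orthonormal_polys M \<rho>" for \<rho>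
  proof -
    have "lead_coeff (\<rho> k) \<in> \<real>" "Re (lead_coeff (\<rho> k)) > 0"
      by (rule is_orthonormal_polysD[OF that])+
    then show ?thesis by (metis Re_complex_of_real Reals_cases)
  qed
  then obtain x y where "x > 0" "y > 0" and xy: "a = of_real (x / y)"
    using pos_lead[OF \<phi>] pos_lead[OF \<psi>] unfolding a_def by auto
  with \<open>a * cnj a = 1\<close> have "(x / y)\<^sup>2 = 1" "x / y > 0"
    by (simp_all only: complex_cnj_complex_of_real power2_eq_square of_real_eq_1_iff flip: of_real_mult)
      simp
  then have "a = 1"
    unfolding xy by (simp add: power2_eq_1_iff)
  with eq show "\<phi> k = \<psi> k" by simp
qed

function gram_schmidt :: "nat \<Rightarrow> complex poly" where
  "gram_schmidt k =
     (let r = monom 1 k - (\<Sum>j<k. smult (ip M (monom 1 k) (gram_schmidt j)) (gram_schmidt j))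
      in smult (1 / of_real (sqrt (Re (ip M r r)))) r)"
  by auto
termination by (relation "Wellfounded.measure id") auto

declare gram_schmidt.simps [simp del]

lemma orthonormal_gram_schmidt: "is_orthonormal_polys M gram_schmidt"
proof -
  \<comment> \<open>The induction controls only indices up to \<open>k\<close>; the remaining inner
    products follow by conjugate symmetry.\<close>
  have main: "degree (gram_schmidt k) = k \<and> lead_coeff (gram_schmidt k) \<in> \<real> \<and>
      Re (lead_coeff (gram_schmidt k)) > 0 \<and>
      (\<forall>j\<le>k. ip M (gram_schmidt k) (gram_schmidt j) = (if j = k then 1 else 0))" for k
  proof (induction k rule: less_induct)
    case (less k)
    define s where "s = (\<Sum>j<k. smult (ip M (monom 1 k) (gram_schmidt j)) (gram_schmidt j))"
    define r where "r = monom 1 k - s"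
    have gs: "gram_schmidt k = smult (1 / of_real (sqrt (Re (ip M r r)))) r"
      by (subst gram_schmidt.simps) (simp add: Let_def r_def s_def)
    \<comment> \<open>The subtracted sum has no coefficients from \<open>k\<close> on, so
      \<open>r\<close> is monic of degree \<open>k\<close> and can be normalized.\<close>
    have coeff_s: "coeff s i = 0" if "i \<ge> k" for i
      unfolding s_def coeff_sum using less that
      by (intro sum.neutral) (auto intro!: coeff_eq_0)
    have ck: "coeff r k = 1" using coeff_s by (simp add: r_def)
    have "degree r \<le> k"
      by (rule degree_le) (simp add: r_def coeff_s)
    with ck have deg: "degree r = k"
      by (simp add: le_degree antisym)
    have "r \<noteq> 0" using ck by auto
    then obtain t where t: "t > 0" "ip M r r = of_real t" using ip_self_pos by blast
    have lead: "lead_coeff (gram_schmidt k) = of_real (1 / sqrt t)"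
      using ck deg t by (simp add: gs)
    have orth: "ip M r (gram_schmidt j) = 0" if "j < k" for j
    proof -
      have "ip M (gram_schmidt i) (gram_schmidt j) = (if i = j then 1 else 0)" if "i < k" for i
      proof (cases "j \<le> i")
        case True then show ?thesis using less[OF that] by auto
      next
        case False
        then have "ip M (gram_schmidt j) (gram_schmidt i) = 0" using less[OF \<open>j < k\<close>] by auto
        then show ?thesis using False ip_cnj[of "gram_schmidt j" "gram_schmidt i"] by simp
      qed
      then have "ip M s (gram_schmidt j) =
          (\<Sum>i<k. if i = j then ip M (monom 1 k) (gram_schmidt i) else 0)"
        unfolding s_def ip_sum_left ip_smult_left by (intro sum.cong) auto
      also have "\<dots> = ip M (monom 1 k) (gram_schmidt j)" using that by simp
      finally show ?thesis by (simp add: r_def ip_diff_left)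
    qed
    define b where "b = 1 / sqrt t"
    have b: "b * (b * t) = 1" using t by (simp add: b_def)
    have "gram_schmidt k = smult (of_real b) r"
      by (simp add: gs t b_def)
    then have "ip M (gram_schmidt k) (gram_schmidt k) = of_real (b * (b * t))"
      by (simp add: ip_smult_left ip_smult_right t)
    then have n1: "ip M (gram_schmidt k) (gram_schmidt k) = 1" by (simp add: b)
    have n0: "ip M (gram_schmidt k) (gram_schmidt j) = 0" if "j < k" for j
      using orth[OF that] by (simp add: gs ip_smult_left)
    have "degree (gram_schmidt k) = k" using deg t by (simp add: gs)
    moreover have "Re (lead_coeff (gram_schmidt k)) > 0"
      by (subst lead) (use t in simp)
    moreover have "lead_coeff (gram_schmidt k) \<in> \<real>"
      by (subst lead) (rule Reals_of_real)
    moreover have "\<forall>j\<le>k. ip M (gram_schmidt k) (gram_schmidt j) = (if j = k then 1 else 0)"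
      using n1 n0 by (simp add: le_less)
    ultimately show ?case by blast
  qed
  have orth: "ip M (gram_schmidt j) (gram_schmidt k) = (if j = k then 1 else 0)" for j k
  proof (cases "k \<le> j")
    case False
    then have "ip M (gram_schmidt k) (gram_schmidt j) = 0" using main[of k] by simp
    then show ?thesis using False ip_cnj[of "gram_schmidt k" "gram_schmidt j"] by simp
  qed (use main[of j] in auto)
  show ?thesis
    unfolding is_orthonormal_polys_def ip_def[symmetric]
    by (intro conjI allI orth main[THEN conjunct1] main[THEN conjunct2, THEN conjunct1]
        main[THEN conjunct2, THEN conjunct2, THEN conjunct1])
qed

abbreviation "\<phi> \<equiv> orthonormal_poly M"

lemma orthonormal_orthonormal_poly: "is_orthonormal_polys M \<phi>"
  unfolding orthonormal_poly_def
proof (rule theI[where P = "is_orthonormal_polys M"])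
  show "is_orthonormal_polys M gram_schmidt" by (rule orthonormal_gram_schmidt)
  show "\<rho> = gram_schmidt" if "is_orthonormal_polys M \<rho>" for \<rho>
    using orthonormal_unique[OF that orthonormal_gram_schmidt] .
qed

lemmas degree_\<phi> [simp] = is_orthonormal_polysD(1)[OF orthonormal_orthonormal_poly]
  and \<phi>_nonzero [simp] = is_orthonormal_polysD(4)[OF orthonormal_orthonormal_poly]
  and ip_\<phi> = is_orthonormal_polysD(5)[OF orthonormal_orthonormal_poly]

lemma ip_\<phi>_lower: "degree p < k \<Longrightarrow> ip M p (\<phi> k) = 0"
  by (rule orthonormal_lower[OF orthonormal_orthonormal_poly disjI2])

section \<open>The reproducing property\<close>

lemma poly_CD_poly: "poly (CD_poly M N w) z = CD_kernel N z w M"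
  by (simp add: CD_poly_def CD_kernel_def poly_sum)

lemma degree_CD_poly_le: "degree (CD_poly M N w) \<le> N"
  unfolding CD_poly_def by (intro degree_sum_le finite_atMost order.trans[OF degree_smult_le]) simp

lemma reproducing:
  assumes "degree p \<le> N"
  shows "ip M p (CD_poly M N w) = poly p w"
proof -
  obtain a where a: "p = (\<Sum>k\<le>N. smult (a k) (\<phi> k))"
    by (rule poly_in_span[OF degree_\<phi> \<phi>_nonzero assms])
  have "ip M p (\<phi> k) = a k" if "k \<le> N" for k
    using that by (subst a) (simp add: ip_sum_left ip_smult_left ip_\<phi> if_distrib cong: if_cong)
  then show ?thesis
    by (simp add: CD_poly_def ip_sum_right ip_smult_right mult.commute)
       (subst a, simp add: poly_sum)
qed

lemma reproducing_left: "degree p \<le> N \<Longrightarrow> ip M (CD_poly M N w) p = cnj (poly p w)"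
  using reproducing[of p N w] ip_cnj[of p "CD_poly M N w"] by simp

text \<open>The difference of the two sides is orthogonal to every polynomial of degree at most
  \<open>N\<close>, itself included. This later identifies the quotient of a combination of the Q_j
  by \<open>G\<close>.\<close>

lemma CD_poly_unique:
  assumes "degree h \<le> N" "\<And>q. degree q \<le> N \<Longrightarrow> ip M h q = a * cnj (poly q w)"
  shows "h = smult a (CD_poly M N w)"
proof -
  define d where "d = h - smult a (CD_poly M N w)"
  have "degree d \<le> N" unfolding d_def
    by (intro degree_diff_le assms(1) order.trans[OF degree_smult_le] degree_CD_poly_le)
  then have "ip M d d = 0"
    by (subst d_def) (simp add: ip_diff_left ip_smult_left assms(2) reproducing_left)
  then have "d = 0" by (rule definite)
  then show ?thesis by (simp add: d_def)
qed

text \<open>On the diagonal the kernel is a sum of squared moduli, and the term for k = 0 is a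
  nonzero constant.\<close>

lemma CD_poly_diag_nonzero: "poly (CD_poly M N w) w \<noteq> 0"
proof
  assume *: "poly (CD_poly M N w) w = 0"
  have "poly (CD_poly M N w) w = of_real (\<Sum>k\<le>N. (norm (poly (\<phi> k) w))\<^sup>2)"
    by (simp add: CD_poly_def poly_sum mult.commute[of "cnj _"] flip: complex_norm_square)
  with * have "(\<Sum>k\<le>N. (norm (poly (\<phi> k) w))\<^sup>2) = 0"
    by (metis of_real_eq_0_iff)
  then have "\<forall>k\<in>{..N}. (norm (poly (\<phi> k) w))\<^sup>2 = 0"
    by (subst (asm) sum_nonneg_eq_0_iff) auto
  then have "poly (\<phi> 0) w = 0" by auto
  moreover obtain c where "\<phi> 0 = [:c:]"
    using degree_\<phi>[of 0] degree_eq_zeroE by blast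
  ultimately show False using \<phi>_nonzero[of 0] by simp
qed

section \<open>Kernels with parameter on the unit circle\<close>

text \<open>If \<open>f\<close> vanishes at \<open>w\<close> on the circle, write \<open>f = (z - w) q\<close>. Multiplication by \<open>z\<close> and by
  \<open>w\<close> are isometries, so \<open>f\<close> cannot be orthogonal to \<open>q\<close> or to \<open>z q\<close>.\<close>

lemma poly_nonzero_on_circle:
  assumes "norm w = 1" "f \<noteq> 0"
    and orth: "\<And>q. f = [:-w, 1:] * q \<Longrightarrow> ip M f q = 0 \<or> ip M f (monom 1 1 * q) = 0"
  shows "poly f w \<noteq> 0"
proof
  assume "poly f w = 0"
  then obtain q where q: "f = [:-w, 1:] * q"
    by (auto simp: poly_eq_0_iff_dvd)
  define g where "g = monom 1 1 * q"
  have f: "f = g - smult w q"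
    by (simp add: q g_def monom_altdef algebra_simps)
  have w: "w * cnj w = 1" using assms(1) complex_norm_square[of w] by simp
  have gg: "ip M g g = ip M q q" unfolding g_def by (rule ip_monom_mult)
  \<comment> \<open>Since \<open>f = g - smult w q\<close>, the value is twice
    \<open>ip M q q\<close> minus twice the real part of \<open>cnj w * ip M g q\<close>. Either
    orthogonality relation makes that product equal to \<open>ip M q q\<close>.\<close>
  have "ip M f f = 0"
    using orth[OF q]
  proof
    assume "ip M f q = 0"
    then have 1: "ip M g q = w * ip M q q" by (simp add: f ip_diff_left ip_smult_left)
    then have "ip M q g = cnj w * ip M q q"
      using ip_cnj[of g q] ip_cnj[of q q] by simp
    with 1 show ?thesis
      using w by (simp add: f ip_diff_left ip_smult_left ip_diff_right ip_smult_right gg algebra_simps)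
  next
    assume "ip M f (monom 1 1 * q) = 0"
    then have 1: "w * ip M q g = ip M q q"
      by (simp add: f ip_diff_left ip_smult_left gg flip: One_nat_def g_def)
    then have "cnj w * ip M g q = ip M q q"
      using ip_cnj[of q g] ip_cnj[of q q] by (metis complex_cnj_mult)
    with 1 show ?thesis
      using w by (simp add: f ip_diff_left ip_smult_left ip_diff_right ip_smult_right gg algebra_simps)
  qed
  then show False using definite \<open>f \<noteq> 0\<close> by blast
qed

text \<open>The quotient of \<open>\<phi> k\<close> by a linear factor has degree k - 1, so
  \<open>\<phi> k\<close> is orthogonal to it.\<close>

lemma \<phi>_nonzero_on_circle:
  assumes "norm w = 1"
  shows "poly (\<phi> k) w \<noteq> 0"
proof (rule poly_nonzero_on_circle[OF assms \<phi>_nonzero])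
  fix q assume "\<phi> k = [:-w, 1:] * q"
  moreover from this have "q \<noteq> 0" using \<phi>_nonzero[of k] by auto
  ultimately have "k = 1 + degree q"
    using degree_mult_eq[of "[:-w, 1:]" q] degree_\<phi>[of k] by simp
  then have "ip M q (\<phi> k) = 0" by (intro ip_\<phi>_lower) simp
  then show "ip M (\<phi> k) q = 0 \<or> ip M (\<phi> k) (monom 1 1 * q) = 0"
    using ip_cnj[of q "\<phi> k"] by simp
qed

text \<open>Only \<open>\<phi> N\<close> contributes to the coefficient at \<open>N\<close>, with a
  factor that is nonzero on the circle.\<close>

lemma degree_CD_poly:
  assumes "norm w = 1"
  shows "degree (CD_poly M N w) = N"
proof -
  have "coeff (CD_poly M N w) N = (\<Sum>k\<le>N. if k = N then cnj (poly (\<phi> k) w) * lead_coeff (\<phi> k) else 0)"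
    unfolding CD_poly_def coeff_sum by (intro sum.cong) (auto intro!: coeff_eq_0)
  also have "\<dots> = cnj (poly (\<phi> N) w) * lead_coeff (\<phi> N)" by simp
  finally have "coeff (CD_poly M N w) N \<noteq> 0"
    using \<phi>_nonzero_on_circle[OF assms] by (simp del: degree_\<phi>)
  then show ?thesis using degree_CD_poly_le[of N w] by (simp add: le_degree antisym)
qed

lemma cnj_CD_poly: "cnj (poly (CD_poly M N w) z) = poly (CD_poly M N z) w"
  by (simp add: CD_poly_def poly_sum mult.commute)

text \<open>Conjugate symmetry swaps the point 0 and the parameter \<open>w\<close>. The kernel with
  parameter 0 is orthogonal to z q, which vanishes at 0, so it has no zero on the circle.\<close>

lemma CD_poly_at_0_nonzero:
  assumes "norm w = 1"
  shows "poly (CD_poly M N w) 0 \<noteq> 0"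
proof -
  have nz: "CD_poly M N 0 \<noteq> 0" using CD_poly_diag_nonzero[of N 0] by auto
  have "poly (CD_poly M N 0) w \<noteq> 0"
  proof (rule poly_nonzero_on_circle[OF assms nz])
    fix q assume q: "CD_poly M N 0 = [:-w, 1:] * q"
    then have "q \<noteq> 0" using nz by auto
    then have "degree (monom 1 1 * q) \<le> N"
      using degree_mult_eq[of "[:-w, 1:]" q] degree_CD_poly_le[of N 0] q
      by (simp add: degree_mult_eq degree_monom_eq)
    then show "ip M (CD_poly M N 0) q = 0 \<or> ip M (CD_poly M N 0) (monom 1 1 * q) = 0"
      by (simp add: reproducing_left poly_monom)
  qed
  then show ?thesis using cnj_CD_poly[of N w 0] by force
qed

end

section \<open>The modified measure \<nu>\<close>

context circle_measure
begin

lemma AE_poly_eq_0_if_ip_self: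
  assumes "ip M p p = 0"
  shows "AE x in M. poly p x = 0"
proof -
  have "integrable M (\<lambda>\<zeta>. (norm (poly p \<zeta>))\<^sup>2)"
    by (intro integrable_continuous continuous_intros)
  moreover have "(LINT \<zeta>|M. (norm (poly p \<zeta>))\<^sup>2) = 0"
    using assms by (simp add: ip_self)
  ultimately show ?thesis
    by (subst (asm) integral_nonneg_eq_0_iff_AE) auto
qed

lemma definite_if_infinite_supp:
  assumes "infinite (supp_measure M)"
  shows "definite_circle_measure M"
  by unfold_locales (rule AE_poly_eq_0[OF assms AE_poly_eq_0_if_ip_self])

lemma measurable_norm_poly: "(\<lambda>\<zeta>. norm (poly G \<zeta>)) \<in> borel_measurable M"
  by (intro measurable_continuous continuous_intros)

lemma circle_measure_modified: "circle_measure (modified_measure G M)"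
proof
  have "integrable M (\<lambda>\<zeta>. norm (poly G \<zeta>))"
    by (intro integrable_continuous continuous_intros)
  then have "(\<integral>\<^sup>+\<zeta>. ennreal (norm (poly G \<zeta>)) \<partial>M) < \<infinity>"
    by (simp add: nn_integral_eq_integral)
  moreover have "emeasure (modified_measure G M) (space M) =
      (\<integral>\<^sup>+\<zeta>. ennreal (norm (poly G \<zeta>)) * indicator (space M) \<zeta> \<partial>M)"
    unfolding modified_measure_def using measurable_norm_poly by (intro emeasure_density) auto
  moreover have "\<dots> = (\<integral>\<^sup>+\<zeta>. ennreal (norm (poly G \<zeta>)) \<partial>M)"
    by (intro nn_integral_cong) simp
  ultimately have "finite_measure (modified_measure G M)"
    by (intro finite_measureI) (simp add: modified_measure_def)
  then show "measure_on_circle (modified_measure G M)"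
    by (simp add: measure_on_circle_def sets_M modified_measure_def)
qed

text \<open>On the support |G| = G / z^m, and 1 / z^m is the conjugate of z^m. Moving that factor to
  the second argument leaves an inner product of polynomials for the original measure.\<close>

lemma ip_modified:
  assumes "\<forall>\<zeta>\<in>supp_measure M. poly G \<zeta> / \<zeta> ^ m \<in> \<real>\<^sub>\<ge>\<^sub>0"
  shows "ip (modified_measure G M) h q = ip M (G * h) (monom 1 m * q)"
proof -
  have "ip (modified_measure G M) h q =
      (LINT \<zeta>|M. norm (poly G \<zeta>) *\<^sub>R (poly h \<zeta> * cnj (poly q \<zeta>)))"
    unfolding ip_def modified_measure_def
    by (intro integral_density measurable_norm_poly measurable_continuous continuous_intros) auto
  also have "\<dots> = ip M (G * h) (monom 1 m * q)"
    unfolding ip_def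
  proof (rule integral_cong_AE)
    show "AE \<zeta> in M. norm (poly G \<zeta>) *\<^sub>R (poly h \<zeta> * cnj (poly q \<zeta>)) =
        poly (G * h) \<zeta> * cnj (poly (monom 1 m * q) \<zeta>)"
      using AE_supp AE_space
    proof eventually_elim
      case (elim \<zeta>)
      have "poly G \<zeta> / \<zeta> ^ m \<in> \<real>\<^sub>\<ge>\<^sub>0" using assms elim(1) by blast
      then obtain r where "r \<ge> 0" "poly G \<zeta> / \<zeta> ^ m = of_real r"
        by (rule nonneg_Reals_cases)
      then have "poly G \<zeta> / \<zeta> ^ m = of_real (norm (poly G \<zeta> / \<zeta> ^ m))" by simp
      also have "\<dots> = of_real (norm (poly G \<zeta>))"
        by (simp add: norm_divide norm_power norm_space[OF elim(2)])
      finally have "of_real (norm (poly G \<zeta>)) = poly G \<zeta> / \<zeta> ^ m" ..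
      also have "\<dots> = poly G \<zeta> * cnj (\<zeta> ^ m)"
        using complex_norm_square[of "\<zeta> ^ m"] norm_space[OF elim(2)]
        by (simp add: norm_power divide_simps mult.assoc) (auto simp: mult.commute)
      finally show ?case
        by (simp add: scaleR_conv_of_real poly_monom)
    qed
  qed (intro measurable_continuous continuous_intros)+
  finally show ?thesis .
qed

text \<open>A polynomial of norm zero for the new measure vanishes almost everywhere off the zeros
  of \<open>G\<close>, so its product with \<open>G\<close> vanishes almost everywhere for
  \<open>M\<close>.\<close>

lemma definite_modified:
  assumes "infinite (supp_measure M)" "G \<noteq> 0"
  shows "definite_circle_measure (modified_measure G M)"
proof -
  interpret N: circle_measure "modified_measure G M" by (rule circle_measure_modified)
  show ?thesis
  proof
    fix p assume "ip (modified_measure G M) p p = 0"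
    then have "AE x in modified_measure G M. poly p x = 0"
      by (rule N.AE_poly_eq_0_if_ip_self)
    then have "AE x in M. 0 < ennreal (norm (poly G x)) \<longrightarrow> poly p x = 0"
      unfolding modified_measure_def using measurable_norm_poly by (subst (asm) AE_density) auto
    then have "AE x in M. poly (G * p) x = 0"
      by eventually_elim auto
    then have "G * p = 0" by (rule AE_poly_eq_0[OF assms(1)])
    with assms(2) show "p = 0" by simp
  qed
qed

end

section \<open>Divisibility and linear independence of polynomials\<close>

lemma prod_linear_dvd:
  fixes f :: "'a::field poly"
  assumes "finite A" "\<forall>a\<in>A. poly f a = 0"
  shows "(\<Prod>a\<in>A. [:-a, 1:]) dvd f"
  using assms
proof (induction A rule: finite_induct)
  case (insert a A)
  then obtain g where g: "f = (\<Prod>a\<in>A. [:-a, 1:]) * g" by (auto elim: dvdE)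
  have "poly (\<Prod>a\<in>A. [:-a, 1:]) a \<noteq> 0"
    using insert.hyps by (auto simp: poly_prod)
  moreover have "poly f a = 0" using insert.prems by simp
  ultimately have "poly g a = 0" by (simp add: g)
  then have "[:-a, 1:] dvd g" by (simp add: poly_eq_0_iff_dvd)
  then have "(\<Prod>a\<in>A. [:-a, 1:]) * [:-a, 1:] dvd f"
    unfolding g by (rule mult_dvd_mono[OF dvd_refl])
  then show ?case
    using insert.hyps by (metis mult.commute prod.insert)
qed simp

text \<open>Alternately the top degree and the value at \<open>0\<close> single out the first summand, and removing
  it turns one family of exponents into the other.\<close>

lemma alternating_independent:
  fixes K :: "nat \<Rightarrow> complex poly"
  assumes deg: "\<And>N. degree (K N) = N" and nz: "\<And>N. poly (K N) 0 \<noteq> 0"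
  shows "(\<Sum>j\<le>d. smult (c j) (monom 1 (j div 2) * K (n + d - j))) = 0 \<Longrightarrow> \<forall>j\<le>d. c j = 0"
    and "(\<Sum>j\<le>d. smult (c j) (monom 1 ((j + 1) div 2) * K (n + d - j))) = 0 \<Longrightarrow> \<forall>j\<le>d. c j = 0"
proof (induction d arbitrary: c)
  case 0
  have [simp]: "K N \<noteq> 0" for N using nz[of N] by auto
  {
    case 1 then show ?case by simp
  next
    case 2 then show ?case by simp
  }
next
  case (Suc d)
  have [simp]: "K N \<noteq> 0" for N using nz[of N] by auto
  have all: "\<forall>j\<le>Suc d. c j = 0" if "c 0 = 0" "\<forall>j\<le>d. c (Suc j) = 0" for c :: "nat \<Rightarrow> complex"
    using that by (metis Suc_le_mono not0_implies_Suc)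
  {
    case 1
    have "coeff (monom 1 (Suc j div 2) * K (n + d - j)) (n + Suc d) = 0" if "j \<le> d" for j
      by (rule coeff_eq_0) (use that in \<open>simp add: degree_mult_eq degree_monom_eq deg\<close>)
    then have "coeff (\<Sum>j\<le>Suc d. smult (c j) (monom 1 (j div 2) * K (n + Suc d - j))) (n + Suc d) =
        c 0 * lead_coeff (K (n + Suc d))"
      by (simp add: sum.atMost_Suc_shift coeff_sum deg del: sum.atMost_Suc)
    then have c0: "c 0 = 0" unfolding 1 coeff_0
      using nz[of "n + Suc d"] by (metis leading_coeff_0_iff mult_eq_0_iff poly_0)
    then have "(\<Sum>j\<le>d. smult (c (Suc j)) (monom 1 ((j + 1) div 2) * K (n + d - j))) = 0"
      using 1 by (simp add: sum.atMost_Suc_shift del: sum.atMost_Suc)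
    from all[OF c0 Suc.IH(2)[OF this]] show ?case .
  next
    case 2
    have "poly (\<Sum>j\<le>Suc d. smult (c j) (monom 1 ((j + 1) div 2) * K (n + Suc d - j))) 0 =
        c 0 * poly (K (n + Suc d)) 0"
      by (simp add: sum.atMost_Suc_shift poly_sum poly_monom del: sum.atMost_Suc)
    then have c0: "c 0 = 0" unfolding 2 poly_0 using nz by (metis mult_eq_0_iff)
    \<comment> \<open>Every remaining exponent is at least 1, so a common factor z can be
      cancelled.\<close>
    have "monom 1 1 * (\<Sum>j\<le>d. smult (c (Suc j)) (monom 1 (j div 2) * K (n + d - j))) =
        (\<Sum>j\<le>d. smult (c (Suc j)) (monom 1 ((Suc j + 1) div 2) * K (n + d - j)))"
      by (simp add: sum_distrib_left mult_monom flip: mult.assoc)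
    also have "\<dots> = 0"
      using 2 c0 by (simp add: sum.atMost_Suc_shift del: sum.atMost_Suc)
    finally have "(\<Sum>j\<le>d. smult (c (Suc j)) (monom 1 (j div 2) * K (n + d - j))) = 0"
      by (simp add: monom_eq_0_iff)
    from all[OF c0 Suc.IH(1)[OF this]] show ?case .
  }
qed

section \<open>Polynomial dependence on the conjugate variable\<close>

text \<open>The closure properties below show that C_n exists as a polynomial without writing out
  its coefficients.\<close>

definition cnj_polynomial :: "(complex \<Rightarrow> complex) \<Rightarrow> bool" where
  "cnj_polynomial f \<longleftrightarrow> (\<exists>p. \<forall>w. f w = poly p (cnj w))"

lemma cnj_polynomial_const: "cnj_polynomial (\<lambda>w. a)"
  unfolding cnj_polynomial_def by (rule exI[of _ "[:a:]"]) simp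

lemma cnj_polynomial_cnj: "cnj_polynomial cnj"
  unfolding cnj_polynomial_def by (rule exI[of _ "[:0, 1:]"]) simp

lemma cnj_polynomial_mult:
  assumes "cnj_polynomial f" "cnj_polynomial g"
  shows "cnj_polynomial (\<lambda>w. f w * g w)"
proof -
  obtain p q where "\<forall>w. f w = poly p (cnj w)" "\<forall>w. g w = poly q (cnj w)"
    using assms unfolding cnj_polynomial_def by blast
  then show ?thesis unfolding cnj_polynomial_def by (intro exI[of _ "p * q"]) simp
qed

lemma cnj_polynomial_add:
  assumes "cnj_polynomial f" "cnj_polynomial g"
  shows "cnj_polynomial (\<lambda>w. f w + g w)"
proof -
  obtain p q where "\<forall>w. f w = poly p (cnj w)" "\<forall>w. g w = poly q (cnj w)"
    using assms unfolding cnj_polynomial_def by blast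
  then show ?thesis unfolding cnj_polynomial_def by (intro exI[of _ "p + q"]) simp
qed

lemma cnj_polynomial_sum:
  "(\<And>i. i \<in> A \<Longrightarrow> cnj_polynomial (f i)) \<Longrightarrow> cnj_polynomial (\<lambda>w. \<Sum>i\<in>A. f i w)"
  by (induction A rule: infinite_finite_induct) (simp_all add: cnj_polynomial_const cnj_polynomial_add)

lemma cnj_polynomial_prod:
  "(\<And>i. i \<in> A \<Longrightarrow> cnj_polynomial (f i)) \<Longrightarrow> cnj_polynomial (\<lambda>w. \<Prod>i\<in>A. f i w)"
  by (induction A rule: infinite_finite_induct) (simp_all add: cnj_polynomial_const cnj_polynomial_mult)

lemma cnj_polynomial_power: "cnj_polynomial f \<Longrightarrow> cnj_polynomial (\<lambda>w. f w ^ k)"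
  by (induction k) (simp_all add: cnj_polynomial_const cnj_polynomial_mult)

lemma cnj_polynomial_cnj_poly: "cnj_polynomial (\<lambda>w. cnj (poly p w))"
proof -
  have "cnj (poly p w) = (\<Sum>i\<le>degree p. cnj (coeff p i) * cnj w ^ i)" for w
    by (simp add: poly_altdef)
  then show ?thesis
    by (simp add: cnj_polynomial_sum cnj_polynomial_mult cnj_polynomial_const
        cnj_polynomial_power cnj_polynomial_cnj)
qed

lemma cnj_polynomial_det:
  assumes "\<And>w. A w \<in> carrier_mat k k"
    and "\<And>i j. i < k \<Longrightarrow> j < k \<Longrightarrow> cnj_polynomial (\<lambda>w. A w $$ (i, j))"
  shows "cnj_polynomial (\<lambda>w. Determinant.det (A w))"
proof -
  have "Determinant.det (A w) =
      (\<Sum>p\<in>{p. p permutes {0..<k}}. signof p * (\<Prod>i=0..<k. A w $$ (i, p i)))" for w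
    using assms(1)[of w] by (rule det_def')
  then show ?thesis
    by (auto intro!: cnj_polynomial_sum cnj_polynomial_mult cnj_polynomial_const
        cnj_polynomial_prod assms(2) simp: permutes_in_image)
qed

section \<open>The determinant formula and its factor C_n\<close>

text \<open>The exponents \<open>e\<close> cover both families at once. The first bound lets z^m
  absorb z^(e j), the second keeps the degree of a combination within n + 2m, and the third makes
  the remaining test polynomial of degree at most n + m - e j fit the kernel of index n + 2m - j.
  The simplicity of the zeros enters as \<open>dvd_of_zeros\<close>.\<close>

locale christoffel = M: definite_circle_measure \<mu> + N: definite_circle_measure "modified_measure G \<mu>"
  for \<mu> G +
  fixes m n :: nat and zs :: "nat \<Rightarrow> complex" and e :: "nat \<Rightarrow> nat"
  assumes ip_mod: "ip (modified_measure G \<mu>) h q = ip \<mu> (G * h) (monom 1 m * q)"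
    and degree_G: "degree G = 2 * m" and G_nonzero: "G \<noteq> 0"
    and dvd_of_zeros: "(\<And>i. i \<in> {1..2 * m} \<Longrightarrow> poly f (zs i) = 0) \<Longrightarrow> G dvd f"
    and zeros: "i \<in> {1..2 * m} \<Longrightarrow> poly G (zs i) = 0"
    and e_le: "j \<le> 2 * m \<Longrightarrow> e j \<le> m" "e j \<le> j" "j \<le> 2 * m \<Longrightarrow> j \<le> m + e j"
begin

abbreviation "\<nu> \<equiv> modified_measure G \<mu>"

definition comb :: "(nat \<Rightarrow> complex) \<Rightarrow> complex \<Rightarrow> complex poly" where
  "comb c w = (\<Sum>j\<le>2 * m. smult (c j) (monom 1 (e j) * CD_poly \<mu> (n + 2 * m - j) w))"

text \<open>With \<open>f = G h\<close>, the \<open>\<nu>\<close>-inner product of \<open>h\<close> and \<open>q\<close> is the \<open>\<mu>\<close>-inner product of \<open>f\<close> and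
  \<open>z\<^sup>m q\<close>, which each reproducing kernel in \<open>f\<close> turns into a multiple of the value of \<open>q\<close> at \<open>w\<close>.\<close>

lemma comb_eq:
  assumes "\<And>i. i \<in> {1..2 * m} \<Longrightarrow> poly (comb c w) (zs i) = 0"
  shows "comb c w = smult (\<Sum>j\<le>2 * m. c j * cnj w ^ (m - e j)) (G * CD_poly \<nu> n w)"
proof -
  let ?a = "\<Sum>j\<le>2 * m. c j * cnj w ^ (m - e j)"
  obtain h where h: "comb c w = G * h"
    using dvd_of_zeros[OF assms] by (auto elim: dvdE)
  have "degree (comb c w) \<le> n + 2 * m"
    unfolding comb_def
  proof (intro degree_sum_le finite_atMost order.trans[OF degree_smult_le])
    fix j assume "j \<in> {..2 * m}"
    then show "degree (monom 1 (e j) * CD_poly \<mu> (n + 2 * m - j) w) \<le> n + 2 * m"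
      using degree_mult_le[of "monom 1 (e j)" "CD_poly \<mu> (n + 2 * m - j) w"] e_le(2)[of j]
        M.degree_CD_poly_le[of "n + 2 * m - j" w]
      by (simp add: degree_monom_eq)
  qed
  then have "degree h \<le> n"
    using h G_nonzero degree_G by (cases "h = 0") (simp_all add: degree_mult_eq)
  moreover have "ip \<nu> h q = ?a * cnj (poly q w)" if q: "degree q \<le> n" for q
  proof -
    have "ip \<mu> (monom 1 (e j) * CD_poly \<mu> (n + 2 * m - j) w) (monom 1 m * q) =
        cnj w ^ (m - e j) * cnj (poly q w)" if "j \<le> 2 * m" for j
    proof -
      \<comment> \<open>The factor z^(e j) common to both arguments cancels by isometry, and the
        reproducing property applies to what is left.\<close>
      have "monom 1 m * q = monom 1 (e j) * (monom 1 (m - e j) * q)"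
        using e_le(1)[OF that] by (simp add: mult_monom flip: mult.assoc)
      moreover have "degree (monom 1 (m - e j) * q) \<le> n + 2 * m - j"
        using degree_mult_le[of "monom 1 (m - e j)" q] q e_le(1,3)[OF that] that
        by (simp add: degree_monom_eq)
      ultimately show ?thesis
        by (simp only: M.ip_monom_mult M.reproducing_left poly_mult poly_monom) simp
    qed
    then show ?thesis
      by (simp add: ip_mod comb_def M.ip_sum_left M.ip_smult_left sum_distrib_right mult.assoc flip: h)
  qed
  ultimately have "h = smult ?a (CD_poly \<nu> n w)"
    by (rule N.CD_poly_unique)
  then show ?thesis by (simp add: h)
qed

abbreviation "Q z w \<equiv> Q_mat \<mu> m zs (\<lambda>j. monom 1 (e j)) n z w"

lemma Q_carrier: "Q z w \<in> carrier_mat (2 * m + 1) (2 * m + 1)"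
  by (simp add: Q_mat_def)

lemma Q_row:
  assumes "i \<le> 2 * m"
  shows "(\<Sum>j<2 * m + 1. Q z w $$ (i, j) * c j) = poly (comb c w) ((zs(0 := z)) i)"
proof -
  have "(\<Sum>j<2 * m + 1. Q z w $$ (i, j) * c j) = (\<Sum>j\<le>2 * m. Q z w $$ (i, j) * c j)"
    by (intro sum.cong) auto
  also have "\<dots> = (\<Sum>j\<le>2 * m. c j * (poly (monom 1 (e j)) ((zs(0 := z)) i) *
      poly (CD_poly \<mu> (n + 2 * m - j) w) ((zs(0 := z)) i)))"
    using assms by (intro sum.cong) (auto simp: Q_mat_def Q_fun_def M.poly_CD_poly)
  finally show ?thesis by (simp add: comb_def poly_sum)
qed

text \<open>Deleting row 0 removes every entry that depends on z, so these cofactors may be taken at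
  z = 0.\<close>

definition minor :: "complex \<Rightarrow> nat \<Rightarrow> complex" where
  "minor w j = cofactor (Q 0 w) 0 j"

lemma det_Q_eq_comb: "Determinant.det (Q z w) = poly (comb (minor w) w) z"
proof -
  have "cofactor (Q z w) 0 j = minor w j" if "j < 2 * m + 1" for j
    unfolding minor_def cofactor_def mat_delete_def
    by (intro arg_cong2[where f = "(*)"] refl arg_cong[where f = Determinant.det] eq_matI)
      (use that in \<open>auto simp: Q_mat_def\<close>)
  then have "Determinant.det (Q z w) = (\<Sum>j<2 * m + 1. Q z w $$ (0, j) * minor w j)"
    by (subst laplace_expansion_row[OF Q_carrier, of 0]) simp_all
  then show ?thesis using Q_row[of 0 z w "minor w"] by simp
qed

text \<open>Setting z to a zero of \<open>G\<close> makes row 0 repeat another row.\<close>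

lemma comb_minor_zero:
  assumes "i \<in> {1..2 * m}"
  shows "poly (comb (minor w) w) (zs i) = 0"
proof -
  have "Matrix.row (Q (zs i) w) 0 = Matrix.row (Q (zs i) w) i"
    using assms by (intro eq_vecI) (auto simp: Q_mat_def)
  then have "Determinant.det (Q (zs i) w) = 0"
    using assms by (intro det_identical_rows[OF Q_carrier, of 0 i]) auto
  then show ?thesis by (simp add: det_Q_eq_comb)
qed

lemma cnj_polynomial_minor: "j < 2 * m + 1 \<Longrightarrow> cnj_polynomial (\<lambda>w. minor w j)"
  unfolding minor_def cofactor_def
proof (intro cnj_polynomial_mult cnj_polynomial_const cnj_polynomial_det[where k = "2 * m"])
  assume j: "j < 2 * m + 1"
  show "mat_delete (Q 0 w) 0 j \<in> carrier_mat (2 * m) (2 * m)" for w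
    using mat_delete_carrier[OF Q_carrier[of 0 w], of 0 j] by simp
  show "cnj_polynomial (\<lambda>w. mat_delete (Q 0 w) 0 j $$ (i, k))" if "i < 2 * m" "k < 2 * m" for i k
    using that j
    by (auto simp: mat_delete_def Q_mat_def Q_fun_def CD_kernel_def intro!: cnj_polynomial_mult
        cnj_polynomial_sum cnj_polynomial_const cnj_polynomial_cnj_poly)
qed

lemma C_poly_identity:
  "Determinant.det (Q z w) =
     poly (C_poly \<mu> m G zs (\<lambda>j. monom 1 (e j)) n) (cnj w) * poly G z * CD_kernel n z w \<nu>"
proof -
  let ?P = "\<lambda>C. \<forall>z w. Determinant.det (Q z w) = poly C (cnj w) * poly G z * CD_kernel n z w \<nu>"
  have "cnj_polynomial (\<lambda>w. \<Sum>j\<le>2 * m. minor w j * cnj w ^ (m - e j))"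
    by (auto intro!: cnj_polynomial_sum cnj_polynomial_mult cnj_polynomial_minor
        cnj_polynomial_power cnj_polynomial_cnj)
  then obtain C where C: "\<And>w. (\<Sum>j\<le>2 * m. minor w j * cnj w ^ (m - e j)) = poly C (cnj w)"
    unfolding cnj_polynomial_def by blast
  have P: "?P C"
    using comb_eq[OF comb_minor_zero] by (simp add: det_Q_eq_comb C N.poly_CD_poly mult.assoc)
  have unique: "D = C" if D: "?P D" for D
  proof (rule ccontr)
    assume "D \<noteq> C"
    \<comment> \<open>On the diagonal z = w the \<nu>-kernel is nonzero and can be cancelled. If
      \<open>D\<close> and \<open>C\<close> differed, the whole plane would lie in a finite
      set.\<close>
    have *: "poly (D - C) (cnj w) = 0 \<or> poly G w = 0" for w
      using D[rule_format, of w w] P[rule_format, of w w] N.CD_poly_diag_nonzero[of n w]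
      by (auto simp: N.poly_CD_poly)
    have "UNIV \<subseteq> cnj ` {x. poly (D - C) x = 0} \<union> {x. poly G x = 0}"
    proof
      fix w show "w \<in> cnj ` {x. poly (D - C) x = 0} \<union> {x. poly G x = 0}"
        using *[of w] image_eqI[of w cnj "cnj w" "{x. poly (D - C) x = 0}"] by auto
    qed
    moreover have "finite \<dots>"
      using poly_roots_finite[of "D - C"] poly_roots_finite[of G] \<open>D \<noteq> C\<close> G_nonzero
      by (intro finite_UnI finite_imageI) simp_all
    ultimately have "finite (UNIV :: complex set)" by (rule finite_subset)
    then show False using infinite_UNIV_char_0 by blast
  qed
  have "?P (THE C. ?P C)"
    by (rule theI[where P = ?P]) (fact P, fact unique)
  then show ?thesis unfolding C_poly_def by blast
qed

text \<open>Reduces the claim to the linear independence of the first-row entries as polynomials in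
  z.\<close>

lemma C_poly_nonzero:
  assumes indep: "\<And>c. comb c w = 0 \<Longrightarrow> \<forall>j\<le>2 * m. c j = 0"
  shows "poly (C_poly \<mu> m G zs (\<lambda>j. monom 1 (e j)) n) (cnj w) \<noteq> 0"
proof
  assume C0: "poly (C_poly \<mu> m G zs (\<lambda>j. monom 1 (e j)) n) (cnj w) = 0"
  have "CD_poly \<nu> n w \<noteq> 0" using N.CD_poly_diag_nonzero[of n w] by auto
  with G_nonzero have nz: "G * CD_poly \<nu> n w \<noteq> 0" by simp
  then obtain z where z: "poly (G * CD_poly \<nu> n w) z \<noteq> 0"
    using poly_all_0_iff_0 by blast
  have "Determinant.det (Q z w) = 0"
    using C0 by (simp add: C_poly_identity)
  then obtain v where v: "v \<in> carrier_vec (2 * m + 1)" "v \<noteq> 0\<^sub>v (2 * m + 1)"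
      "Q z w *\<^sub>v v = 0\<^sub>v (2 * m + 1)"
    using det_0_iff_vec_prod_zero[OF Q_carrier] by blast
  let ?c = "\<lambda>j. v $ j"
  have zero: "poly (comb ?c w) ((zs(0 := z)) i) = 0" if "i \<le> 2 * m" for i
  proof -
    have "(Q z w *\<^sub>v v) $ i = (\<Sum>j<2 * m + 1. Q z w $$ (i, j) * ?c j)"
      using that v(1) Q_carrier[of z w]
      by (auto simp: scalar_prod_def lessThan_atLeast0 intro!: sum.cong)
    then show ?thesis using v(3) that Q_row[OF that] by simp
  qed
  have "poly (comb ?c w) (zs i) = 0" if "i \<in> {1..2 * m}" for i
    using zero[of i] that by simp
  then have eq: "comb ?c w = smult (\<Sum>j\<le>2 * m. ?c j * cnj w ^ (m - e j)) (G * CD_poly \<nu> n w)"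
    by (rule comb_eq)
  moreover have "poly (comb ?c w) z = 0" using zero[of 0] by simp
  \<comment> \<open>The combination is a scalar multiple of a polynomial that is nonzero at
    \<open>z\<close>, so the scalar is 0.\<close>
  ultimately have "comb ?c w = 0" using z by simp
  then have "\<forall>j\<le>2 * m. ?c j = 0" by (rule indep)
  then have "v = 0\<^sub>v (2 * m + 1)"
    using v(1) by (intro eq_vecI) auto
  with v(2) show False by simp
qed

end

section \<open>Application to the two exponent families\<close>

theorem corollary1p5:
  fixes \<mu> :: "complex measure"
    and m n :: nat
    and G :: "complex poly"
    and zs :: "nat \<Rightarrow> complex"
    and w :: complex
  assumes "nontrivial_measure_on_circle \<mu>"
    and "m \<ge> 1"
    and "Polynomial.degree G = 2 * m"
    and "self_reciprocal (2 * m) G"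
    and "\<forall>\<zeta> \<in> supp_measure \<mu>. poly G \<zeta> / \<zeta> ^ m \<in> \<real>\<^sub>\<ge>\<^sub>0"
    and "G = Polynomial.smult (lead_coeff G) (\<Prod>i = 1..2 * m. [:- zs i, 1:])"
    and "\<forall>a. poly G a = 0 \<longrightarrow> Polynomial.order a G = 1"
    and "norm w = 1"
  shows "poly (C_poly \<mu> m G zs p_fam n) w \<noteq> 0 \<and> poly (C_poly \<mu> m G zs p_hat_fam n) w \<noteq> 0"
proof -
  have G0: "G \<noteq> 0" using assms(2,3) by auto
  have inf: "infinite (supp_measure \<mu>)" and "circle_measure \<mu>"
    using assms(1) by (auto simp: nontrivial_measure_on_circle_def circle_measure_def)
  then interpret circle_measure \<mu> by blast
  have zeros: "poly G (zs i) = 0" if "i \<in> {1..2 * m}" for i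
    using that by (subst assms(6)) (auto simp: poly_prod)
  \<comment> \<open>A repeated value would give \<open>G\<close> a double zero.\<close>
  have inj: "inj_on zs {1..2 * m}"
  proof (rule inj_onI, rule ccontr)
    fix i k assume ik: "i \<in> {1..2 * m}" "k \<in> {1..2 * m}" "zs i = zs k" "i \<noteq> k"
    have "(\<Prod>l\<in>{i, k}. [:- zs l, 1:]) dvd (\<Prod>l = 1..2 * m. [:- zs l, 1:])"
      using ik by (intro prod_dvd_prod_subset) auto
    then have "[:- zs i, 1:] ^ 2 dvd G"
      using ik by (subst assms(6)) (simp add: power2_eq_square dvd_smult)
    then have "2 \<le> Polynomial.order (zs i) G"
      using G0 by (simp add: order_divides)
    with assms(7) zeros[OF ik(1)] show False by simp
  qed
  have dvd: "G dvd f" if "\<And>i. i \<in> {1..2 * m} \<Longrightarrow> poly f (zs i) = 0" for f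
  proof -
    have "(\<Prod>a\<in>zs ` {1..2 * m}. [:- a, 1:]) dvd f"
      using that by (intro prod_linear_dvd) auto
    then have "(\<Prod>i = 1..2 * m. [:- zs i, 1:]) dvd f"
      by (simp only: prod.reindex[OF inj] comp_def)
    then show ?thesis
      using G0 by (subst assms(6)) (simp add: smult_dvd)
  qed
  have christoffel: "christoffel \<mu> G m zs e"
    if "\<And>j. j \<le> 2 * m \<Longrightarrow> e j \<le> m" "\<And>j. e j \<le> j" "\<And>j. j \<le> 2 * m \<Longrightarrow> j \<le> m + e j" for e
    by (intro christoffel.intro christoffel_axioms.intro definite_if_infinite_supp definite_modified
        ip_modified inf G0 assms(3,5) dvd zeros that)
  interpret definite_circle_measure \<mu> using inf by (rule definite_if_infinite_supp)
  \<comment> \<open>C_n is evaluated at the conjugate of the kernel parameter, so the parameter is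
    taken to be \<open>cnj w\<close>, again on the circle.\<close>
  have w: "norm (cnj w) = 1" using assms(8) by simp
  interpret P: christoffel \<mu> G m n zs "\<lambda>j. j div 2" by (rule christoffel) auto
  interpret P': christoffel \<mu> G m n zs "\<lambda>j. (j + 1) div 2" by (rule christoffel) auto
  note indep = alternating_independent[OF degree_CD_poly[OF w] CD_poly_at_0_nonzero[OF w]]
  show ?thesis
    using P.C_poly_nonzero[of "cnj w"] P'.C_poly_nonzero[of "cnj w"] indep
    unfolding P.comb_def P'.comb_def p_fam_def[abs_def] p_hat_fam_def[abs_def] by simp
qed

end
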